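(* Let $\mathcal{H}$ be a complex Hilbert space and let $(M,\Sigma,\mu_M)$ be a measure space. Suppose that $\{f_k\}_{k\in M}$ is a basic Riesz family in $\mathcal{H}$ with respect to $(M,\Sigma,\mu_M)$ that is essentially norm bounded, i.e., $C:=\sup_{k\in M}\|f_k\|<\infty$ (supremum understood up to $\mu_M$-null sets). Then $\{f_k\}_{k\in M}$ is a discrete family. Furthermore, $$\inf_{E\in\Sigma_0}\mu_M(E)>0,\qquad \text{where } \Sigma_0=\{E\in\Sigma : \mu_M(E)>0\}.$$
   Context: Let $\mathcal{K}=\overline{\operatorname{span}}\{f_k\}_{k\in M}$. The family $F=\{f_k\}_{k\in M}$ is a basic frame (with respect to $(M,\Sigma,\mu_M)$) if $k\mapsto\langle f,f_k\rangle$ is measurable for every $f\in\mathcal{K}$ and there are constants $A,B>0$ (frame bounds) such that $A\|f\|^2\le\int_M|\langle f,f_k\rangle|^2\,d\mu_M(k)\le B\|f\|^2$ for all $f\in\mathcal{K}$. Its analysis operator is $C_F:\mathcal{H}\to L^2(M,\mu_M)$, $C_Ff=(k\mapsto\langle f,f_k\rangle)$. A basic frame with bounds $A,B$ is a basic Riesz family with bounds $A,B$ if $C_F$ has dense range in $L^2(M,\mu_M)$. Equivalently, for all simple integrable functions $a$ on $M$, $A\|a\|_{L^2(M)}^2\le\big\|\int_M a(k)f_k\,d\mu_M(k)\big\|^2\le B\|a\|_{L^2(M)}^2$, the vector-valued integral being defined weakly. A set $E\in\Sigma$ of positive measure is an atom if for every measurable $F\subset E$ either $\mu_M(F)=0$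 or $\mu_M(E\setminus F)=0$. A measure is purely atomic if every measurable set of positive measure contains an atom. The family $\{f_k\}_{k\in M}$ is called discrete if $\mu_M$ is purely atomic on $\sigma$-finite subsets, i.e., for every $\sigma$-finite $K\in\Sigma$ the restriction of $\mu_M$ to $\{E\cap K : E\in\Sigma\}$ is purely atomic. *)

theory Defs
  imports "HOL-Analysis.Analysis"
begin

section \<open>Complex Hilbert spaces\<close>

text \<open>
  The inner product is linear in its first argument, so that the analysis operator below is linear.
  Norm, distance and topology come from \<^class>\<open>real_normed_vector\<close>; the last axiom says that this
  norm is the one induced by the inner product.
\<close>

class complex_inner = real_normed_vector +
  fixes scaleC :: "complex \<Rightarrow> 'a \<Rightarrow> 'a" (infixr "*\<^sub>C" 75)
    and cinner :: "'a \<Rightarrow> 'a \<Rightarrow> complex"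
  assumes scaleC_add_right: "c *\<^sub>C (x + y) = c *\<^sub>C x + c *\<^sub>C y"
    and scaleC_add_left: "(c + d) *\<^sub>C x = c *\<^sub>C x + d *\<^sub>C x"
    and scaleC_scaleC: "c *\<^sub>C (d *\<^sub>C x) = (c * d) *\<^sub>C x"
    and scaleC_one: "1 *\<^sub>C x = x"
    and scaleR_scaleC: "scaleR r x = complex_of_real r *\<^sub>C x"
    and cinner_commute: "cinner x y = cnj (cinner y x)"
    and cinner_add_left: "cinner (x + y) z = cinner x z + cinner y z"
    and cinner_scaleC_left: "cinner (c *\<^sub>C x) y = c * cinner x y"
    and cinner_self: "cinner x x = complex_of_real ((norm x)\<^sup>2)"

class chilbert_space = complex_inner + complete_space

global_interpretation complex_vector: vector_space "scaleC :: complex \<Rightarrow> 'a \<Rightarrow> 'a::complex_inner"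
  by unfold_locales (simp_all add: scaleC_add_right scaleC_add_left scaleC_scaleC scaleC_one)

instantiation complex :: chilbert_space
begin

definition scaleC_complex :: "complex \<Rightarrow> complex \<Rightarrow> complex" where
  "scaleC_complex c x = c * x"

definition cinner_complex :: "complex \<Rightarrow> complex \<Rightarrow> complex" where
  "cinner_complex x y = x * cnj y"

instance
proof
  fix x :: complex
  show "cinner x x = complex_of_real ((norm x)\<^sup>2)"
    unfolding cinner_complex_def by (rule complex_norm_square [symmetric])
qed (simp_all add: scaleC_complex_def cinner_complex_def distrib_left distrib_right mult.assoc
      scaleR_conv_of_real mult.commute)

end


section \<open>Square integrable functions\<close>

text \<open>
  Functions themselves rather than classes modulo null sets; \<open>L2_norm\<close> is the corresponding seminorm.
\<close>

definition L2 :: "'k measure \<Rightarrow> ('k \<Rightarrow> complex) set" where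
  "L2 M = {g \<in> borel_measurable M. integrable M (\<lambda>k. (cmod (g k))\<^sup>2)}"

definition L2_norm :: "'k measure \<Rightarrow> ('k \<Rightarrow> complex) \<Rightarrow> real" where
  "L2_norm M g = sqrt (\<integral>k. (cmod (g k))\<^sup>2 \<partial>M)"


section \<open>Basic frames and basic Riesz families\<close>

text \<open>
  A family indexed by a measure space \<open>M\<close> is a function of which only the values on \<^term>\<open>space M\<close> matter.
\<close>

definition closed_span :: "'k measure \<Rightarrow> ('k \<Rightarrow> 'h::chilbert_space) \<Rightarrow> 'h set" where
  "closed_span M f = closure (complex_vector.span (f ` space M))"

definition analysis_operator :: "('k \<Rightarrow> 'h::chilbert_space) \<Rightarrow> 'h \<Rightarrow> 'k \<Rightarrow> complex" where
  "analysis_operator f h = (\<lambda>k. cinner h (f k))"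

definition basic_frame ::
  "'k measure \<Rightarrow> ('k \<Rightarrow> 'h::chilbert_space) \<Rightarrow> real \<Rightarrow> real \<Rightarrow> bool" where
  "basic_frame M f A B \<longleftrightarrow> A > 0 \<and> B > 0 \<and>
     (\<forall>h\<in>closed_span M f.
        (\<lambda>k. cinner h (f k)) \<in> borel_measurable M \<and>
        ennreal (A * (norm h)\<^sup>2) \<le> (\<integral>\<^sup>+k. ennreal ((cmod (cinner h (f k)))\<^sup>2) \<partial>M) \<and>
        (\<integral>\<^sup>+k. ennreal ((cmod (cinner h (f k)))\<^sup>2) \<partial>M) \<le> ennreal (B * (norm h)\<^sup>2))"

text \<open>
  The second conjunct says that the analysis operator has dense range in \<open>L2 M\<close>. For a basic frame its
  range automatically lies in \<open>L2 M\<close>: on \<^term>\<open>space M\<close>, replacing \<open>h\<close> by its orthogonal projection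
  onto \<open>closed_span M f\<close> does not change \<open>analysis_operator f h\<close>. So the norm below is always that of
  an element of \<open>L2 M\<close>.
\<close>

definition basic_Riesz_family ::
  "'k measure \<Rightarrow> ('k \<Rightarrow> 'h::chilbert_space) \<Rightarrow> real \<Rightarrow> real \<Rightarrow> bool" where
  "basic_Riesz_family M f A B \<longleftrightarrow> basic_frame M f A B \<and>
     (\<forall>g\<in>L2 M. \<forall>\<epsilon>>0. \<exists>h. L2_norm M (\<lambda>k. g k - analysis_operator f h k) < \<epsilon>)"

text \<open>
  \<open>AE\<close> is used because \<open>k \<mapsto> norm (f k)\<close> need not be measurable when the space is not separable.
\<close>

definition essentially_norm_bounded ::
  "'k measure \<Rightarrow> ('k \<Rightarrow> 'h::chilbert_space) \<Rightarrow> bool" where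
  "essentially_norm_bounded M f \<longleftrightarrow> (\<exists>C::real. AE k in M. norm (f k) \<le> C)"


section \<open>Atoms and discrete families\<close>

definition is_atom :: "'k measure \<Rightarrow> 'k set \<Rightarrow> bool" where
  "is_atom M E \<longleftrightarrow> E \<in> sets M \<and> emeasure M E > 0 \<and>
     (\<forall>F\<in>sets M. F \<subseteq> E \<longrightarrow> emeasure M F = 0 \<or> emeasure M (E - F) = 0)"

definition purely_atomic :: "'k measure \<Rightarrow> bool" where
  "purely_atomic M \<longleftrightarrow> (\<forall>E\<in>sets M. emeasure M E > 0 \<longrightarrow> (\<exists>F\<subseteq>E. is_atom M F))"

text \<open>Discreteness of a family is a property of its index measure space only.\<close>

definition discrete_family :: "'k measure \<Rightarrow> ('k \<Rightarrow> 'h::chilbert_space) \<Rightarrow> bool" where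
  "discrete_family M f \<longleftrightarrow>
     (\<forall>K\<in>sets M. sigma_finite_measure (restrict_space M K) \<longrightarrow> purely_atomic (restrict_space M K))"

end

theory Submission
  imports Defs
begin

text \<open>
  Vectors of a norm bounded family cannot resolve small sets. Let \<open>E\<close> have measure \<open>\<mu>\<close> with
  \<open>0 < \<mu> < \<infinity>\<close>. By density of the range, the indicator of \<open>E\<close> is within \<open>sqrt \<mu> / 2\<close> in \<open>L\<^sup>2\<close> of
  some coefficient function \<open>u k = cinner p (f k)\<close> with \<open>p\<close> in the closed span. The lower frame
  bound then makes \<open>norm p\<close> of order \<open>sqrt (\<mu> / A)\<close>, so by Cauchy-Schwarz \<open>u\<close> is almost
  everywhere of order at most \<open>C * sqrt (\<mu> / A)\<close>. If \<open>\<mu>\<close> were much smaller than \<open>A / C\<^sup>2\<close>, then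
  \<open>u\<close> would be small on all of \<open>E\<close> and could not approximate the constant \<open>1\<close> there. Making
  this quantitative gives \<open>A \<le> 10 * C\<^sup>2 * \<mu>\<close> (\<open>measure_lower_bound\<close>), hence one positive
  lower bound for all positive measures.

  Such a gap \<open>\<delta>\<close> forces atoms: a set of finite positive measure that is not an atom splits into two
  parts of positive measure, each smaller than the whole by at least \<open>\<delta>\<close>, so that repeated
  splitting has to stop at an atom (\<open>purely_atomic_if_measures_bounded_below\<close>).

  One point needs the geometry of Hilbert space. Density of the range provides an approximant from an
  arbitrary \<open>h\<close>, whereas the frame inequalities, and even measurability of the coefficient
  function, are available only for vectors in the closed span. Replacing \<open>h\<close> by its orthogonal
  projection leaves all coefficients unchanged (\<open>orthogonal_projection_exists\<close>).
\<close>


section \<open>Orthogonal projection in complex Hilbert spaces\<close>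

lemma cinner_add_right: "cinner x (y + z) = cinner x y + cinner x z"
  for x y z :: "'a::complex_inner"
  using cinner_add_left[of y z x]
  unfolding cinner_commute[of x "y + z"] cinner_commute[of x y] cinner_commute[of x z] by simp

lemma cinner_scaleC_right: "cinner x (c *\<^sub>C y) = cnj c * cinner x y"
  for x y :: "'a::complex_inner"
  using cinner_scaleC_left[of c y x]
  unfolding cinner_commute[of x "c *\<^sub>C y"] cinner_commute[of x y] by simp

lemma norm_add_squared: "(norm (x + y))\<^sup>2 = (norm x)\<^sup>2 + (norm y)\<^sup>2 + 2 * Re (cinner x y)"
  for x y :: "'a::complex_inner"
proof -
  have "complex_of_real ((norm (x + y))\<^sup>2) = cinner (x + y) (x + y)"
    by (simp add: cinner_self)
  also have "\<dots> = cinner x x + cinner y y + (cinner x y + cnj (cinner x y))"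
    using cinner_commute[of y x] by (simp add: cinner_add_left cinner_add_right)
  also have "\<dots> = complex_of_real ((norm x)\<^sup>2 + (norm y)\<^sup>2 + 2 * Re (cinner x y))"
    by (simp add: cinner_self complex_add_cnj)
  finally show ?thesis
    by (simp only: of_real_eq_iff)
qed

lemma cinner_minus_right: "cinner x (- y) = - cinner x y"
  for x y :: "'a::complex_inner"
  using cinner_add_right[of x y "- y"] cinner_add_right[of x 0 0]
  by (simp add: eq_neg_iff_add_eq_0 add.commute)

lemma norm_diff_squared: "(norm (x - y))\<^sup>2 = (norm x)\<^sup>2 + (norm y)\<^sup>2 - 2 * Re (cinner x y)"
  for x y :: "'a::complex_inner"
  using norm_add_squared[of x "- y"] by (simp add: cinner_minus_right)

lemma parallelogram_law:
  "(norm (x + y))\<^sup>2 + (norm (x - y))\<^sup>2 = 2 * (norm x)\<^sup>2 + 2 * (norm y)\<^sup>2"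
  for x y :: "'a::complex_inner"
  by (simp add: norm_add_squared norm_diff_squared)

lemma norm_scaleC_squared: "(norm (c *\<^sub>C x))\<^sup>2 = (cmod c)\<^sup>2 * (norm x)\<^sup>2"
  for x :: "'a::complex_inner"
proof -
  have "complex_of_real ((norm (c *\<^sub>C x))\<^sup>2) = c * cnj c * cinner x x"
    unfolding cinner_self[symmetric] by (simp add: cinner_scaleC_left cinner_scaleC_right)
  also have "\<dots> = complex_of_real ((cmod c)\<^sup>2 * (norm x)\<^sup>2)"
    unfolding complex_norm_square[symmetric] cinner_self by simp
  finally show ?thesis
    by (simp only: of_real_eq_iff)
qed

text \<open>
  The vector subtracted from \<open>x\<close> points along the component of \<open>x\<close> in the direction \<open>y\<close>, which
  makes the cross term real. Choosing \<open>t\<close> well yields both Cauchy-Schwarz and the orthogonality of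
  shortest vectors.
\<close>

lemma norm_diff_scaleC_cinner_squared:
  fixes x y :: "'a::complex_inner"
  shows "(norm (x - (complex_of_real t * cinner x y) *\<^sub>C y))\<^sup>2 =
    (norm x)\<^sup>2 - 2 * t * (cmod (cinner x y))\<^sup>2 + t\<^sup>2 * (cmod (cinner x y))\<^sup>2 * (norm y)\<^sup>2"
proof -
  have "cinner x ((complex_of_real t * cinner x y) *\<^sub>C y)
      = complex_of_real (t * (cmod (cinner x y))\<^sup>2)"
    unfolding cinner_scaleC_right of_real_mult complex_norm_square by simp
  then show ?thesis
    by (simp add: norm_diff_squared norm_scaleC_squared norm_mult power_mult_distrib)
qed

lemma Cauchy_Schwarz_cinner: "cmod (cinner x y) \<le> norm x * norm y"
  for x y :: "'a::complex_inner"
proof (cases "y = 0")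
  case True
  then show ?thesis
    using cinner_scaleC_right[of x 0 y] by simp
next
  case False
  then have "(norm y)\<^sup>2 > 0" by simp
  have "0 \<le> (norm (x - (complex_of_real (1 / (norm y)\<^sup>2) * cinner x y) *\<^sub>C y))\<^sup>2"
    by simp
  also have "\<dots> = (norm x)\<^sup>2 - (cmod (cinner x y))\<^sup>2 / (norm y)\<^sup>2"
    using \<open>(norm y)\<^sup>2 > 0\<close> unfolding norm_diff_scaleC_cinner_squared
    by (simp add: power2_eq_square)
  finally have "(cmod (cinner x y))\<^sup>2 \<le> (norm x * norm y)\<^sup>2"
    using \<open>(norm y)\<^sup>2 > 0\<close> by (simp add: field_simps)
  then show ?thesis
    by (rule power2_le_imp_le) simp
qed

text \<open>
  Were \<open>w\<close> not orthogonal to \<open>v\<close>, moving a small step \<open>t\<close> against its component along \<open>v\<close>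
  would shorten it: the gain is linear in \<open>t\<close>, the loss quadratic.
\<close>

lemma shortest_vector_orthogonal:
  fixes w :: "'a::complex_inner"
  assumes V: "complex_vector.subspace V" and v: "v \<in> V"
    and min: "\<And>v. v \<in> V \<Longrightarrow> norm w \<le> norm (w - v)"
  shows "cinner w v = 0"
proof (rule ccontr)
  assume "cinner w v \<noteq> 0"
  then have c: "(cmod (cinner w v))\<^sup>2 > 0" (is "?c > 0") by simp
  define t where "t = 1 / ((norm v)\<^sup>2 + 1)"
  have "(norm v)\<^sup>2 + 1 > 0"
    by (simp add: add_nonneg_pos)
  then have t: "t > 0" "t * (norm v)\<^sup>2 < 1"
    by (simp_all add: t_def)
  have "(norm w)\<^sup>2 \<le> (norm (w - (complex_of_real t * cinner w v) *\<^sub>C v))\<^sup>2"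
    by (intro power_mono min complex_vector.subspace_scale[OF V v]) simp
  then have "?c * (2 * t) \<le> ?c * (t * (t * (norm v)\<^sup>2))"
    unfolding norm_diff_scaleC_cinner_squared by (simp add: power2_eq_square algebra_simps)
  then have "2 * t \<le> t * (t * (norm v)\<^sup>2)"
    using c by (simp only: mult_le_cancel_left_pos)
  also have "\<dots> < t * 1"
    using t by (intro mult_strict_left_mono)
  finally show False
    using t by simp
qed

text \<open>
  The point \<open>p\<close> is the limit of a sequence in \<open>V\<close> minimizing the distance to \<open>h\<close>; the
  parallelogram law makes every such sequence Cauchy. Taking the sequence in \<open>V\<close> itself avoids
  having to show that the closure of \<open>V\<close> is a subspace.
\<close>

lemma orthogonal_projection_exists:
  fixes V :: "'h::chilbert_space set"
  assumes V: "complex_vector.subspace V"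
  obtains p where "p \<in> closure V" and "\<And>v. v \<in> V \<Longrightarrow> cinner h v = cinner p v"
proof -
  define d where "d = infdist h V"
  have ne: "V \<noteq> {}"
    using complex_vector.subspace_0[OF V] by auto
  have d0: "0 \<le> d"
    by (simp add: d_def infdist_nonneg)
  have d_le: "d \<le> norm (h - v)" if "v \<in> V" for v
    using infdist_le[OF that, of h] by (simp add: d_def dist_norm)
  have "\<exists>v\<in>V. norm (h - v) < d + e" if "e > 0" for e
  proof -
    have "(INF v\<in>V. dist h v) < d + e"
      using that by (simp add: d_def infdist_notempty[OF ne])
    then show ?thesis
      using cINF_less_iff[OF ne bdd_below_image_dist] by (simp add: dist_norm)
  qed
  then have "\<forall>n. \<exists>v\<in>V. norm (h - v) < d + inverse (real (Suc n))"
    by simp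
  then obtain x where xV: "\<And>n. x n \<in> V" and x: "\<And>n. norm (h - x n) < d + inverse (real (Suc n))"
    by metis
  have lim: "(\<lambda>n. norm (h - x n)) \<longlonglongrightarrow> d"
  proof (rule tendsto_sandwich[OF _ _ tendsto_const])
    show "(\<lambda>n. d + inverse (real (Suc n))) \<longlonglongrightarrow> d"
      using tendsto_add[OF tendsto_const LIMSEQ_inverse_real_of_nat] by simp
    show "\<forall>\<^sub>F n in sequentially. d \<le> norm (h - x n)"
      by (intro always_eventually allI d_le xV)
    show "\<forall>\<^sub>F n in sequentially. norm (h - x n) \<le> d + inverse (real (Suc n))"
      by (intro always_eventually allI less_imp_le x)
  qed
  \<comment> \<open>The midpoint of \<open>x m\<close> and \<open>x n\<close> lies in \<open>V\<close>, hence is no closer to \<open>h\<close> than \<open>d\<close>.\<close>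
  have step: "(norm (x m - x n))\<^sup>2 \<le> 2 * ((norm (h - x m))\<^sup>2 - d\<^sup>2) + 2 * ((norm (h - x n))\<^sup>2 - d\<^sup>2)"
    for m n
  proof -
    define z where "z = (1/2) *\<^sub>R (x m + x n)"
    have "z \<in> V"
      unfolding z_def scaleR_scaleC
      by (intro complex_vector.subspace_scale[OF V] complex_vector.subspace_add[OF V] xV)
    have "(h - x n) + (h - x m) = 2 *\<^sub>R (h - z)"
      by (simp add: z_def algebra_simps scaleR_2)
    then have "(norm ((h - x n) + (h - x m)))\<^sup>2 = 4 * (norm (h - z))\<^sup>2"
      by (simp add: power_mult_distrib)
    moreover have "d\<^sup>2 \<le> (norm (h - z))\<^sup>2"
      using d_le[OF \<open>z \<in> V\<close>] d0 by (rule power_mono)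
    ultimately show ?thesis
      using parallelogram_law[of "h - x n" "h - x m"] by simp
  qed
  have "Cauchy x"
  proof (rule metric_CauchyI)
    fix e :: real assume e: "e > 0"
    have "(\<lambda>n. (norm (h - x n))\<^sup>2 - d\<^sup>2) \<longlonglongrightarrow> d\<^sup>2 - d\<^sup>2"
      by (intro tendsto_intros lim)
    then have "eventually (\<lambda>n. (norm (h - x n))\<^sup>2 - d\<^sup>2 < e\<^sup>2 / 4) sequentially"
      using e by (intro order_tendstoD(2)) auto
    then obtain N where N: "\<And>n. n \<ge> N \<Longrightarrow> (norm (h - x n))\<^sup>2 - d\<^sup>2 < e\<^sup>2 / 4"
      by (auto simp: eventually_sequentially)
    have "dist (x m) (x n) < e" if "m \<ge> N" "n \<ge> N" for m n
      unfolding dist_norm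
    proof (rule power2_less_imp_less)
      show "(norm (x m - x n))\<^sup>2 < e\<^sup>2"
        using step[of m n] N[OF that(1)] N[OF that(2)] by (simp add: field_simps)
    qed (use e in simp)
    then show "\<exists>N. \<forall>m\<ge>N. \<forall>n\<ge>N. dist (x m) (x n) < e" by blast
  qed
  then obtain p where p: "x \<longlonglongrightarrow> p"
    using Cauchy_convergent convergent_def by blast
  have "norm (h - p) = d"
    using LIMSEQ_unique[OF lim] tendsto_norm[OF tendsto_diff[OF tendsto_const p]] by metis
  have "norm (h - p) \<le> norm (h - p - v)" if "v \<in> V" for v
  proof -
    have "(\<lambda>n. norm (h - x n - v)) \<longlonglongrightarrow> norm (h - p - v)"
      by (intro tendsto_intros p)
    moreover have "d \<le> norm (h - x n - v)" for n
      using d_le[OF complex_vector.subspace_add[OF V xV that]] by (simp add: diff_diff_eq)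
    ultimately show ?thesis
      using \<open>norm (h - p) = d\<close> by (intro Lim_bounded2[where N = 0]) auto
  qed
  then have "cinner (h - p) v = 0" if "v \<in> V" for v
    using shortest_vector_orthogonal[OF V that] by blast
  then have "cinner h v = cinner p v" if "v \<in> V" for v
    using cinner_add_left[of "h - p" p v] that by simp
  moreover have "p \<in> closure V"
    using xV p by (auto simp: closure_sequential)
  ultimately show thesis
    using that by blast
qed

section \<open>Approximation by coefficient functions\<close>

lemma basic_frame_bounds:
  fixes f :: "'k \<Rightarrow> 'h::chilbert_space"
  assumes F: "basic_frame M f A B" and p: "p \<in> closed_span M f"
  shows "analysis_operator f p \<in> L2 M"
    and "A * (norm p)\<^sup>2 \<le> (\<integral>k. (cmod (analysis_operator f p k))\<^sup>2 \<partial>M)"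
proof -
  have A: "A > 0" and meas: "analysis_operator f p \<in> borel_measurable M"
    and lower: "ennreal (A * (norm p)\<^sup>2) \<le> (\<integral>\<^sup>+k. ennreal ((cmod (analysis_operator f p k))\<^sup>2) \<partial>M)"
    and upper: "(\<integral>\<^sup>+k. ennreal ((cmod (analysis_operator f p k))\<^sup>2) \<partial>M) \<le> ennreal (B * (norm p)\<^sup>2)"
    using F p by (auto simp: basic_frame_def analysis_operator_def)
  have int: "integrable M (\<lambda>k. (cmod (analysis_operator f p k))\<^sup>2)"
    using meas upper by (intro integrableI_bounded) (auto intro: le_less_trans)
  then show "analysis_operator f p \<in> L2 M"
    using meas by (simp add: L2_def)
  show "A * (norm p)\<^sup>2 \<le> (\<integral>k. (cmod (analysis_operator f p k))\<^sup>2 \<partial>M)"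
    using lower A by (subst (asm) nn_integral_eq_integral[OF int]) auto
qed

text \<open>
  Density of the range, with the approximating vector moved into the closed span, where the frame
  inequalities apply to it.
\<close>

lemma basic_Riesz_family_approximation:
  fixes f :: "'k \<Rightarrow> 'h::chilbert_space"
  assumes R: "basic_Riesz_family M f A B" and g: "g \<in> L2 M" and e: "e > 0"
  obtains p where "p \<in> closed_span M f" "L2_norm M (\<lambda>k. g k - analysis_operator f p k) < e"
proof -
  obtain h where h: "L2_norm M (\<lambda>k. g k - analysis_operator f h k) < e"
    using R g e by (auto simp: basic_Riesz_family_def)
  obtain p where "p \<in> closure (complex_vector.span (f ` space M))"
    and p: "\<And>v. v \<in> complex_vector.span (f ` space M) \<Longrightarrow> cinner h v = cinner p v"
    using orthogonal_projection_exists[OF complex_vector.subspace_span] by blast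
  have "L2_norm M (\<lambda>k. g k - analysis_operator f p k) = L2_norm M (\<lambda>k. g k - analysis_operator f h k)"
    unfolding L2_norm_def analysis_operator_def
    by (intro arg_cong[where f = sqrt] Bochner_Integration.integral_cong)
       (simp_all add: p complex_vector.span_base)
  then show thesis
    using that[of p] h \<open>p \<in> _\<close> by (simp add: closed_span_def)
qed

text \<open>
  This crude form of the triangle inequality integrates termwise; it takes the place of Minkowski's
  inequality below and only affects the numerical constant.
\<close>

lemma norm_add_squared_le: "(norm (x + y))\<^sup>2 \<le> 2 * (norm x)\<^sup>2 + 2 * (norm y)\<^sup>2"
  for x y :: "'a::complex_inner"
  using parallelogram_law[of x y] zero_le_power2[of "norm (x - y)"] by linarith

lemma L2_diff: "g - u \<in> L2 M" if "g \<in> L2 M" "u \<in> L2 M"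
proof -
  have [measurable]: "g \<in> borel_measurable M" "u \<in> borel_measurable M"
    using that by (auto simp: L2_def)
  have "integrable M (\<lambda>k. (cmod (g k - u k))\<^sup>2)"
  proof (rule Bochner_Integration.integrable_bound)
    show "integrable M (\<lambda>k. 2 * (cmod (g k))\<^sup>2 + 2 * (cmod (u k))\<^sup>2)"
      using that by (auto simp: L2_def)
    show "AE k in M. norm ((cmod (g k - u k))\<^sup>2) \<le> norm (2 * (cmod (g k))\<^sup>2 + 2 * (cmod (u k))\<^sup>2)"
      using norm_add_squared_le[of "g k" "- u k" for k] by auto
  qed measurable
  then show ?thesis
    by (simp add: L2_def fun_diff_def)
qed

lemma integral_squared_le:
  assumes "g \<in> L2 M" "u \<in> L2 M"
  shows "(\<integral>k. (cmod (g k))\<^sup>2 \<partial>M)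
    \<le> 2 * (\<integral>k. (cmod (u k))\<^sup>2 \<partial>M) + 2 * (\<integral>k. (cmod (g k - u k))\<^sup>2 \<partial>M)"
proof -
  have "(\<integral>k. (cmod (g k))\<^sup>2 \<partial>M) \<le> (\<integral>k. 2 * (cmod (u k))\<^sup>2 + 2 * (cmod (g k - u k))\<^sup>2 \<partial>M)"
    using assms L2_diff[OF assms] norm_add_squared_le[of "u k" "g k - u k" for k]
    by (intro integral_mono) (auto simp: L2_def)
  also have "\<dots> = 2 * (\<integral>k. (cmod (u k))\<^sup>2 \<partial>M) + 2 * (\<integral>k. (cmod (g k - u k))\<^sup>2 \<partial>M)"
    using assms L2_diff[OF assms] by (subst Bochner_Integration.integral_add) (auto simp: L2_def)
  finally show ?thesis .
qed

section \<open>The lower bound for positive measures\<close>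

text \<open>
  Both terms of \<open>1 \<le> 2 * (cmod (u k))\<^sup>2 + 2 * (cmod (1 - u k))\<^sup>2\<close> are controlled when integrated
  over \<open>E\<close>: the second by the quality of the approximation, relative to \<open>\<mu>\<close>, and the first by
  \<open>C\<^sup>2 * (norm p)\<^sup>2 * \<mu>\<close>, which is quadratic in \<open>\<mu>\<close> because \<open>(norm p)\<^sup>2\<close> is itself at most a
  multiple of \<open>\<mu>\<close>. A quadratic term can balance the linear left side only if \<open>\<mu>\<close> is not too small.
\<close>

lemma measure_lower_bound:
  fixes f :: "'k \<Rightarrow> 'h::chilbert_space"
  assumes R: "basic_Riesz_family M f A B" and C: "AE k in M. norm (f k) \<le> C"
    and E: "E \<in> sets M" "emeasure M E < \<infinity>" "measure M E > 0"
  shows "A \<le> 10 * C\<^sup>2 * measure M E"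
proof -
  define \<mu> where "\<mu> = measure M E"
  define g :: "'k \<Rightarrow> complex" where "g = (\<lambda>k. of_real (indicator E k))"
  have \<mu>: "\<mu> > 0" and A: "A > 0" and F: "basic_frame M f A B"
    using E R by (auto simp: \<mu>_def basic_Riesz_family_def basic_frame_def)
  have g2: "(cmod (g k))\<^sup>2 = indicator E k" for k
    by (simp add: g_def indicator_def)
  have g: "g \<in> L2 M"
    using E by (simp add: L2_def g2) (simp add: g_def)
  have int_g: "(\<integral>k. (cmod (g k))\<^sup>2 \<partial>M) = \<mu>"
    using E by (simp add: g2 \<mu>_def)
  obtain p where p: "p \<in> closed_span M f"
    and close: "L2_norm M (\<lambda>k. g k - analysis_operator f p k) < sqrt \<mu> / 2"
    using basic_Riesz_family_approximation[OF R g, of "sqrt \<mu> / 2"] \<mu> by auto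
  define u where "u = analysis_operator f p"
  note u = basic_frame_bounds[OF F p, folded u_def]
  \<comment> \<open>The accuracy \<open>sqrt \<mu> / 2\<close> makes the error term below at most \<open>\<mu> / 2\<close>, half of the squared norm of \<open>g\<close>.\<close>
  have "L2_norm M (\<lambda>k. g k - u k) < sqrt (\<mu> / 4)"
    using close by (simp add: u_def real_sqrt_divide)
  then have gu: "(\<integral>k. (cmod (g k - u k))\<^sup>2 \<partial>M) < \<mu> / 4"
    by (simp add: L2_norm_def)
  have "(\<integral>k. (cmod (u k))\<^sup>2 \<partial>M) \<le> 2 * \<mu> + 2 * (\<mu> / 4)"
    using integral_squared_le[OF u(1) g] gu by (simp add: int_g norm_minus_commute)
  with u(2) have norm_p: "A * (norm p)\<^sup>2 \<le> 5 / 2 * \<mu>" by simp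
  \<comment> \<open>On \<open>E\<close> one has \<open>g = 1\<close>, and Cauchy-Schwarz bounds \<open>u\<close> by \<open>C * norm p\<close>; off \<open>E\<close> the left side vanishes.\<close>
  have "AE k in M. indicator E k \<le> 2 * (C\<^sup>2 * (norm p)\<^sup>2) * indicator E k + 2 * (cmod (g k - u k))\<^sup>2"
    using C
  proof eventually_elim
    case (elim k)
    have "cmod (u k) \<le> norm p * norm (f k)"
      unfolding u_def analysis_operator_def by (rule Cauchy_Schwarz_cinner)
    also have "\<dots> \<le> norm p * C"
      using elim by (rule mult_left_mono) simp
    finally have "(cmod (u k))\<^sup>2 \<le> (norm p * C)\<^sup>2"
      by (rule power_mono) simp
    then show ?case
      using norm_add_squared_le[of "u k" "g k - u k"]
      by (auto simp: indicator_def g_def power_mult_distrib mult.commute)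
  qed
  then have "(\<integral>k. indicator E k \<partial>M)
      \<le> (\<integral>k. 2 * (C\<^sup>2 * (norm p)\<^sup>2) * indicator E k + 2 * (cmod (g k - u k))\<^sup>2 \<partial>M)"
    using E L2_diff[OF g u(1)]
    by (intro integral_mono_AE Bochner_Integration.integrable_add integrable_mult_right)
       (auto simp: L2_def)
  also have "\<dots> = 2 * (C\<^sup>2 * (norm p)\<^sup>2) * \<mu> + 2 * (\<integral>k. (cmod (g k - u k))\<^sup>2 \<partial>M)"
    using E L2_diff[OF g u(1)]
    by (subst Bochner_Integration.integral_add) (auto simp: L2_def \<mu>_def)
  also have "\<dots> \<le> 2 * (C\<^sup>2 * (norm p)\<^sup>2) * \<mu> + \<mu> / 2"
    using gu by simp
  also have "(\<integral>k. indicator E k \<partial>M) = \<mu>"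
    using E by (simp add: \<mu>_def)
  finally have "1 * \<mu> \<le> (4 * (C\<^sup>2 * (norm p)\<^sup>2)) * \<mu>"
    by linarith
  then have "1 \<le> 4 * (C\<^sup>2 * (norm p)\<^sup>2)"
    using \<mu> by (simp only: mult_le_cancel_right_pos)
  then have "A * 1 \<le> A * (4 * (C\<^sup>2 * (norm p)\<^sup>2))"
    using A by (intro mult_left_mono) auto
  also have "\<dots> = 4 * C\<^sup>2 * (A * (norm p)\<^sup>2)" by simp
  also have "\<dots> \<le> 4 * C\<^sup>2 * (5 / 2 * \<mu>)"
    using norm_p by (intro mult_left_mono) auto
  finally show ?thesis
    by (simp add: \<mu>_def ac_simps)
qed

section \<open>A gap in the values of a measure forces atoms\<close>

text \<open>
  The induction is on the number of steps of length \<open>\<delta>\<close> that fit below the measure of \<open>E\<close>: if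
  \<open>E\<close> is no atom, then it has a part of positive measure whose complement in \<open>E\<close> has measure at
  least \<open>\<delta>\<close>.
\<close>

lemma atom_exists:
  fixes N :: "'k measure" and \<delta> :: real
  assumes \<delta>: "\<delta> > 0"
    and gap: "\<And>E. E \<in> sets N \<Longrightarrow> emeasure N E > 0 \<Longrightarrow> ennreal \<delta> \<le> emeasure N E"
  shows "E \<in> sets N \<Longrightarrow> emeasure N E > 0 \<Longrightarrow> emeasure N E < ennreal (real n * \<delta>)
    \<Longrightarrow> \<exists>F\<subseteq>E. is_atom N F"
proof (induction n arbitrary: E)
  case 0
  then show ?case by simp
next
  case (Suc n)
  show ?case
  proof (cases "is_atom N E")
    case True
    then show ?thesis by blast
  next
    case False
    then obtain G where G: "G \<in> sets N" "G \<subseteq> E" "emeasure N G > 0" "emeasure N (E - G) > 0"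
      using Suc.prems by (auto simp: is_atom_def zero_less_iff_neq_zero)
    have "emeasure N G + ennreal \<delta> \<le> emeasure N G + emeasure N (E - G)"
      using gap[of "E - G"] G Suc.prems by (intro add_left_mono) auto
    also have "\<dots> = emeasure N E"
      using G Suc.prems by (subst plus_emeasure) (auto simp: Un_absorb1)
    also have "\<dots> < ennreal (real n * \<delta>) + ennreal \<delta>"
      using Suc.prems(3) \<delta> by (simp add: algebra_simps flip: ennreal_plus)
    finally have "emeasure N G < ennreal (real n * \<delta>)"
      by (metis add_right_mono leD not_le_imp_less)
    from Suc.IH[OF G(1,3) this] show ?thesis
      using G by blast
  qed
qed

text \<open>
  \<open>\<sigma>\<close>-finiteness serves to shrink a set of infinite measure to a part of finite positive measure,
  from which the descent to an atom can start.
\<close>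

lemma purely_atomic_if_measures_bounded_below:
  fixes N :: "'k measure" and \<delta> :: real
  assumes \<delta>: "\<delta> > 0" and sf: "sigma_finite_measure N"
    and gap: "\<And>E. E \<in> sets N \<Longrightarrow> emeasure N E > 0 \<Longrightarrow> ennreal \<delta> \<le> emeasure N E"
  shows "purely_atomic N"
  unfolding purely_atomic_def
proof (intro ballI impI)
  fix E assume E: "E \<in> sets N" "emeasure N E > 0"
  interpret sigma_finite_measure N by fact
  obtain F where F: "F \<in> sets N" "F \<subseteq> E" "emeasure N F > 0" "emeasure N F < \<infinity>"
  proof -
    obtain S :: "nat \<Rightarrow> _" where S: "range S \<subseteq> sets N" "(\<Union>i. S i) = space N" "\<And>i. emeasure N (S i) \<noteq> \<infinity>"
      using sigma_finite by metis
    have "\<exists>i. emeasure N (E \<inter> S i) > 0"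
    proof (rule ccontr)
      assume "\<not> ?thesis"
      then have "emeasure N (\<Union>i. E \<inter> S i) = 0"
        using E S by (intro emeasure_UN_eq_0) auto
      moreover have "(\<Union>i. E \<inter> S i) = E"
        using S(2) sets.sets_into_space[OF E(1)] by auto
      ultimately show False
        using E by simp
    qed
    then obtain i where i: "emeasure N (E \<inter> S i) > 0" by blast
    have "emeasure N (E \<inter> S i) \<le> emeasure N (S i)"
      using S by (intro emeasure_mono) auto
    also have "emeasure N (S i) < \<infinity>"
      using S(3)[of i] unfolding infinity_ennreal_def by (rule top.not_eq_extremum[THEN iffD1])
    finally have "emeasure N (E \<inter> S i) < \<infinity>" .
    moreover have "E \<inter> S i \<in> sets N"
      using E(1) S(1) by auto
    ultimately show thesis
      using that[of "E \<inter> S i"] i by blast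
  qed
  obtain n where "measure N F / \<delta> < real n"
    using reals_Archimedean2 by blast
  then have "emeasure N F < ennreal (real n * \<delta>)"
    using \<delta> F(4) by (simp add: emeasure_eq_ennreal_measure ennreal_less_iff field_simps)
  then have "\<exists>G\<subseteq>F. is_atom N G"
    using atom_exists[OF \<delta> gap F(1,3)] by simp
  then show "\<exists>F\<subseteq>E. is_atom N F"
    using F(2) by (meson order_trans)
qed

section \<open>Norm bounded basic Riesz families are discrete\<close>

theorem proposition3p3:
  fixes M :: "'k measure" and f :: "'k \<Rightarrow> 'h::chilbert_space" and A B :: real
  assumes "basic_Riesz_family M f A B"
    and "essentially_norm_bounded M f"
  shows "discrete_family M f \<and> (INF E\<in>{E \<in> sets M. emeasure M E > 0}. emeasure M E) > 0"
proof -
  obtain C\<^sub>0 where "AE k in M. norm (f k) \<le> C\<^sub>0"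
    using assms(2) by (auto simp: essentially_norm_bounded_def)
  \<comment> \<open>The maximum with \<open>1\<close> keeps the denominator of \<open>\<delta>\<close> positive even if \<open>C\<^sub>0 = 0\<close>.\<close>
  define C where "C = max 1 C\<^sub>0"
  have C: "AE k in M. norm (f k) \<le> C" and C1: "C \<ge> 1"
    using \<open>AE k in M. norm (f k) \<le> C\<^sub>0\<close> by (auto simp: C_def)
  define \<delta> where "\<delta> = A / (10 * C\<^sup>2)"
  have \<delta>: "\<delta> > 0"
    using assms(1) C1 by (auto simp: \<delta>_def basic_Riesz_family_def basic_frame_def)
  have gap: "ennreal \<delta> \<le> emeasure M E" if E: "E \<in> sets M" "emeasure M E > 0" for E
  proof (cases "emeasure M E < \<infinity>")
    case True
    then have eq: "emeasure M E = ennreal (measure M E)"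
      by (simp add: emeasure_eq_ennreal_measure)
    then have "measure M E > 0"
      using E by simp
    then have "A \<le> 10 * C\<^sup>2 * measure M E"
      using measure_lower_bound[OF assms(1) C E(1) True] by simp
    then have "\<delta> \<le> measure M E"
      using C1 by (simp add: \<delta>_def field_simps)
    then show ?thesis
      by (simp add: eq ennreal_leI)
  next
    case False
    then show ?thesis by (simp add: less_top[symmetric])
  qed
  have "discrete_family M f"
    unfolding discrete_family_def
  proof (intro ballI impI)
    fix K assume K: "K \<in> sets M" "sigma_finite_measure (restrict_space M K)"
    show "purely_atomic (restrict_space M K)"
    proof (rule purely_atomic_if_measures_bounded_below[OF \<delta> K(2)])
      fix E assume "E \<in> sets (restrict_space M K)" "emeasure (restrict_space M K) E > 0"
      with K show "ennreal \<delta> \<le> emeasure (restrict_space M K) E"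
        using gap[of E] by (simp add: sets_restrict_space_iff emeasure_restrict_space)
    qed
  qed
  moreover have "ennreal \<delta> \<le> (INF E\<in>{E \<in> sets M. emeasure M E > 0}. emeasure M E)"
    using gap by (intro INF_greatest) auto
  ultimately show ?thesis
    using \<delta> by (auto intro: less_le_trans[of 0 "ennreal \<delta>"])
qed

end
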